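(* Let $g$ be a U-shaped function on a compact real interval $I=[a,b]$ and let $X$ be a random variable whose law depends on $g$. Let $\widehat G$ be an estimator, based on $X$ and taking values in $\mathcal{H}(I)$, of the function $G(t)=\int_a^t g(s)\,ds$, $t\in I$. Set $Z=\widehat G-G$ and $\widetilde g=U_S(\widehat G)$. For $\pi\in\Pi(I)$ let $\widehat g^{\pi}$ be the histogram $$\widehat g^{\pi}(t)=\sum_{k\in\mathcal{K}^\pi}\frac{\widehat G(t_k^\pi)-\widehat G(t_{k-1}^\pi)}{t_k^\pi-t_{k-1}^\pi}\,\mathbb{1}_{[t_{k-1}^\pi,t_k^\pi)}(t),\qquad t\in I,$$ and let $$\mathcal{R}_Z(\pi)=4\,d(g,\mathcal{H}_\pi)+C\sum_{k\in\mathcal{K}^\pi}\mathbb{E}\left(\sup_{t\in[t_{k-1}^\pi,t_k^\pi]}|Z(t)-Z(t_{k-1}^\pi)|\right),$$ where $C\ge1$ is the absolute constant described in the context. Assume that there exists a positive constant $A$ such that for all $\pi\in\Pi(I)$ and all $k\in\mathcal{K}^\pi$, $$\mathbb{E}\left(\sup_{t\in[t_{k-1}^\pi,t_k^\pi]}|Z(t)-Z(t_{k-1}^\pi)|\right)\le A\,\mathbb{E}\left(|Z(t_k^\pi)-Z(t_{k-1}^\pi)|\right).$$ Then for all $\pi\in\Pi(I)$, $$(CA+8)^{-1}\mathcal{R}_Z(\pi)\le\mathbb{E}\|\widehat g^{\pi}-g\|\le\mathcal{R}_Z(\pi).$$ Moreover, $$\mathbb{E}\|\widetilde g-g\|\le(CA+8)\inf_{\pi\in\Pi(I)}\mathbb{E}\|\widehat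 g^{\pi}-g\|.$$
   Context: The constant $C$: $C\ge1$ is an absolute constant such that the inequality $\mathbb{E}\|\widetilde g-g\|\le\inf_{\pi\in\Pi(I)}\mathcal{R}_Z(\pi)$ holds for every U-shaped $g$ on a compact interval $I=[a,b]$ and every $\mathcal{H}(I)$-valued estimator $\widehat G$ of $G$ (with $Z$, $\widetilde g$ and $\mathcal{R}_Z$ defined as in the claim). Such a constant exists and $C=49$ works. A function $g$ on $I=[a,b]$ is U-shaped if there is some $m\in I$ such that $g$ is nonincreasing on $[a,m]$ and nondecreasing on $[m,b]$. $\mathcal{H}(I)$ is the cone of nondecreasing, right-continuous with left-hand limits (cadlag) step functions on $I$. An estimator $\widehat G\in\mathcal{H}(I)$ based on $X$ is a (measurable) function of $X$ with values in $\mathcal{H}(I)$. U-shaped regularization: for $F\in\mathcal{H}(I)$ and $m\in I$, $\widetilde F_S^m$ is the function on $I$ defined on $[a,m]$ as the least concave majorant of the restriction of $F$ to $[a,m]$, and on $[m,b]$ as the greatest convex minorant of the restriction of $F$ to $[m,b]$. $U_S^m(F)$ is the right-hand continuous slope (right-hand derivative) of $\widetilde F_S^m$. The mapping $U_S$: let $d_S(m)=\sup_{t\in I}|F(t)-\widetilde F_S^m(t)|$ for $m\in I$. This is a cadlag step function on $I$ whose discontinuity points belong to the set of discontinuity points of $F$. Let $m(F)$ be the midpoint of the interval where $d_S$ achieves its minimum. Then $U_S(F)=U_S^{m(F)}(F)$. Norm and distance: $\|f-g\|=\int_I|f(t)-g(t)|\,dt$ and, for $\mathcal{H}\subset\mathbb{L}_1(I)$,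 $d(f,\mathcal{H})=\inf_{h\in\mathcal{H}}\|f-h\|$. Partitions: $\Pi(I)$ is the set of all finite partitions $\pi=([t_{k-1}^\pi,t_k^\pi))_{k\in\mathcal{K}^\pi}$ of $I$ into intervals, where $a=t_0^\pi<\cdots<t_{D^\pi}^\pi=b$, $\mathcal{K}^\pi=\{1,\dots,D^\pi\}$ and $D^\pi$ is an arbitrary positive integer. $\mathcal{H}_\pi$ is the set of cadlag step functions on $I$ that are constant on every $[t_{k-1}^\pi,t_k^\pi)$, $k\in\mathcal{K}^\pi$. *)

theory Defs
  imports "HOL-Probability.Probability"
begin

text \<open>
  Functions on \<open>I = [a,b]\<close> are represented by functions \<open>real \<Rightarrow> real\<close> whose values outside
  \<open>{a..b}\<close> are never used.  Norms and expectations take values in \<open>ennreal\<close>, so that an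
  expectation that is not finite is \<open>\<infinity>\<close> instead of the default value \<open>0\<close> of the Bochner integral.
\<close>

definition U_shaped :: "real \<Rightarrow> real \<Rightarrow> (real \<Rightarrow> real) \<Rightarrow> bool" where
  "U_shaped a b g \<longleftrightarrow> (\<exists>m\<in>{a..b}. antimono_on {a..m} g \<and> mono_on {m..b} g)"

text \<open>A partition \<open>a = t\<^sub>0 < \<dots> < t\<^sub>D = b\<close> is the pair \<open>(D, t)\<close>; entries of \<open>t\<close> beyond \<open>D\<close> are
  irrelevant.\<close>

type_synonym partition = "nat \<times> (nat \<Rightarrow> real)"

abbreviation pieces :: "partition \<Rightarrow> nat set" where
  "pieces \<pi> \<equiv> {1..fst \<pi>}"

abbreviation knot :: "partition \<Rightarrow> nat \<Rightarrow> real" where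
  "knot \<pi> \<equiv> snd \<pi>"

definition partitions :: "real \<Rightarrow> real \<Rightarrow> partition set" where
  "partitions a b =
     {(D, t). 1 \<le> D \<and> t 0 = a \<and> t D = b \<and> (\<forall>k\<in>{1..D}. t (k - 1) < t k)}"

definition cadlag_on :: "real \<Rightarrow> real \<Rightarrow> (real \<Rightarrow> real) \<Rightarrow> bool" where
  "cadlag_on a b f \<longleftrightarrow>
     (\<forall>t\<in>{a..<b}. continuous (at_right t) f) \<and>
     (\<forall>t\<in>{a<..b}. \<exists>l. (f \<longlongrightarrow> l) (at_left t))"

text \<open>The value at the right end point \<open>b\<close> is free, since no \<open>[t\<^sub>k\<^sub>-\<^sub>1, t\<^sub>k)\<close> contains \<open>b\<close>.\<close>

definition H_part :: "real \<Rightarrow> real \<Rightarrow> partition \<Rightarrow> (real \<Rightarrow> real) set" where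
  "H_part a b \<pi> =
     {h. cadlag_on a b h \<and> (\<forall>k\<in>pieces \<pi>. h constant_on {knot \<pi> (k - 1)..<knot \<pi> k})}"

definition H_cone :: "real \<Rightarrow> real \<Rightarrow> (real \<Rightarrow> real) set" where
  "H_cone a b = {F. mono_on {a..b} F \<and> (\<exists>\<pi>\<in>partitions a b. F \<in> H_part a b \<pi>)}"

definition L1_dist :: "real \<Rightarrow> real \<Rightarrow> (real \<Rightarrow> real) \<Rightarrow> (real \<Rightarrow> real) \<Rightarrow> ennreal" where
  "L1_dist a b f h = (\<integral>\<^sup>+t\<in>{a..b}. ennreal \<bar>f t - h t\<bar> \<partial>lborel)"

definition L1_dist_set :: "real \<Rightarrow> real \<Rightarrow> (real \<Rightarrow> real) \<Rightarrow> (real \<Rightarrow> real) set \<Rightarrow> ennreal" where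
  "L1_dist_set a b f H = (INF h\<in>H. L1_dist a b f h)"

definition least_concave_majorant :: "real set \<Rightarrow> (real \<Rightarrow> real) \<Rightarrow> real \<Rightarrow> real" where
  "least_concave_majorant S F t =
     Inf {h t |h. concave_on S h \<and> (\<forall>s\<in>S. F s \<le> h s)}"

definition greatest_convex_minorant :: "real set \<Rightarrow> (real \<Rightarrow> real) \<Rightarrow> real \<Rightarrow> real" where
  "greatest_convex_minorant S F t =
     Sup {h t |h. convex_on S h \<and> (\<forall>s\<in>S. h s \<le> F s)}"

lemma least_concave_majorant:
  assumes S: "convex S" and bdd: "bdd_above (F ` S)"
  shows "concave_on S (least_concave_majorant S F)"
    and "\<And>t. t \<in> S \<Longrightarrow> F t \<le> least_concave_majorant S F t"
    and "\<And>h t. concave_on S h \<Longrightarrow> (\<And>s. s \<in> S \<Longrightarrow> F s \<le> h s) \<Longrightarrow> t \<in> S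
           \<Longrightarrow> least_concave_majorant S F t \<le> h t"
proof -
  let ?V = "\<lambda>t. {h t |h. concave_on S h \<and> (\<forall>s\<in>S. F s \<le> h s)}"
  obtain B where "\<And>s. s \<in> S \<Longrightarrow> F s \<le> B"
    using bdd by (auto simp: bdd_above_def)
  then have "concave_on S (\<lambda>_. B) \<and> (\<forall>s\<in>S. F s \<le> B)"
    using S by (simp add: concave_on_const)
  then have ne: "?V t \<noteq> {}" for t by blast
  have bd: "bdd_below (?V t)" if "t \<in> S" for t
    using that by (intro bdd_belowI[of _ "F t"]) auto
  show ge: "F t \<le> least_concave_majorant S F t" if "t \<in> S" for t
    unfolding least_concave_majorant_def
    using ne that by (intro cInf_greatest) auto
  show le: "least_concave_majorant S F t \<le> h t"
    if "concave_on S h" "\<And>s. s \<in> S \<Longrightarrow> F s \<le> h s" "t \<in> S" for h t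
    unfolding least_concave_majorant_def
    using bd that by (intro cInf_lower) auto
  show "concave_on S (least_concave_majorant S F)"
    unfolding concave_on_iff
  proof (intro conjI S ballI allI impI)
    fix x y u v :: real
    assume *: "x \<in> S" "y \<in> S" "0 \<le> u" "0 \<le> v" "u + v = 1"
    have xy: "u *\<^sub>R x + v *\<^sub>R y \<in> S" using S * by (simp add: convex_def)
    show "u * least_concave_majorant S F x + v * least_concave_majorant S F y
            \<le> least_concave_majorant S F (u *\<^sub>R x + v *\<^sub>R y)"
      unfolding least_concave_majorant_def[of S F "u *\<^sub>R x + v *\<^sub>R y"]
    proof (rule cInf_greatest[OF ne], clarify)
      fix h assume h: "concave_on S h" "\<forall>s\<in>S. F s \<le> h s"
      have "u * least_concave_majorant S F x + v * least_concave_majorant S F y \<le> u * h x + v * h y"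
        using * h le by (intro add_mono mult_left_mono) auto
      also have "\<dots> \<le> h (u *\<^sub>R x + v *\<^sub>R y)"
        using h * by (simp add: concave_on_iff)
      finally show "u * least_concave_majorant S F x + v * least_concave_majorant S F y
         \<le> h (u *\<^sub>R x + v *\<^sub>R y)" .
    qed
  qed
qed

lemma greatest_convex_minorant_eq:
  "greatest_convex_minorant S F t = - least_concave_majorant S (\<lambda>s. - F s) t"
proof -
  have "{h t |h. convex_on S h \<and> (\<forall>s\<in>S. h s \<le> F s)}
      = uminus ` {h t |h. concave_on S h \<and> (\<forall>s\<in>S. - F s \<le> h s)}" (is "?L = uminus ` ?R")
  proof (intro equalityI subsetI)
    fix y assume "y \<in> ?L"
    then obtain h where "y = h t" "convex_on S h" "\<forall>s\<in>S. h s \<le> F s" by auto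
    then show "y \<in> uminus ` ?R"
      by (intro image_eqI[of _ _ "- y"]) (auto simp: concave_on_def intro!: exI[of _ "\<lambda>s. - h s"])
  next
    fix y assume "y \<in> uminus ` ?R"
    then obtain h where "y = - h t" "concave_on S h" "\<forall>s\<in>S. - F s \<le> h s" by auto
    then show "y \<in> ?L"
      by (auto simp: concave_on_def minus_le_iff intro!: exI[of _ "\<lambda>s. - h s"])
  qed
  then show ?thesis
    unfolding greatest_convex_minorant_def least_concave_majorant_def
    by (simp add: Inf_real_def image_image)
qed

lemma greatest_convex_minorant:
  assumes S: "convex S" and bdd: "bdd_below (F ` S)"
  shows "convex_on S (greatest_convex_minorant S F)"
    and "\<And>t. t \<in> S \<Longrightarrow> greatest_convex_minorant S F t \<le> F t"
    and "\<And>h t. convex_on S h \<Longrightarrow> (\<And>s. s \<in> S \<Longrightarrow> h s \<le> F s) \<Longrightarrow> t \<in> S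
           \<Longrightarrow> h t \<le> greatest_convex_minorant S F t"
proof -
  have b: "bdd_above ((\<lambda>s. - F s) ` S)"
    using bdd by (simp add: bdd_above_uminus flip: image_image)
  note l = least_concave_majorant[OF S b]
  show "convex_on S (greatest_convex_minorant S F)"
    using l(1) by (simp add: greatest_convex_minorant_eq[abs_def] concave_on_def)
  show "greatest_convex_minorant S F t \<le> F t" if "t \<in> S" for t
    using l(2)[OF that] by (simp add: greatest_convex_minorant_eq)
  show "h t \<le> greatest_convex_minorant S F t"
    if "convex_on S h" "\<And>s. s \<in> S \<Longrightarrow> h s \<le> F s" "t \<in> S" for h t
    using l(3)[of "\<lambda>s. - h s" t] that by (simp add: greatest_convex_minorant_eq concave_on_def)
qed

text \<open>For nondecreasing \<open>F\<close> both branches below take the value \<open>F m\<close> at \<open>t = m\<close>.\<close>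

definition U_reg :: "real \<Rightarrow> real \<Rightarrow> real \<Rightarrow> (real \<Rightarrow> real) \<Rightarrow> real \<Rightarrow> real" where
  "U_reg a b m F t =
     (if t \<le> m then least_concave_majorant {a..m} F t
      else greatest_convex_minorant {m..b} F t)"

text \<open>The right-hand derivative; its value at \<open>b\<close> is unspecified and plays no role, because
  the slope is used only through its \<open>L\<^sup>1\<close> distance to other functions.\<close>

definition U_slope :: "real \<Rightarrow> real \<Rightarrow> real \<Rightarrow> (real \<Rightarrow> real) \<Rightarrow> real \<Rightarrow> real" where
  "U_slope a b m F t =
     Lim (at t within {t<..b}) (\<lambda>s. (U_reg a b m F s - U_reg a b m F t) / (s - t))"

definition U_gap :: "real \<Rightarrow> real \<Rightarrow> (real \<Rightarrow> real) \<Rightarrow> real \<Rightarrow> real" where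
  "U_gap a b F m = (SUP t\<in>{a..b}. \<bar>F t - U_reg a b m F t\<bar>)"

definition U_argmin :: "real \<Rightarrow> real \<Rightarrow> (real \<Rightarrow> real) \<Rightarrow> real set" where
  "U_argmin a b F = {m\<in>{a..b}. \<forall>m'\<in>{a..b}. U_gap a b F m \<le> U_gap a b F m'}"

text \<open>For \<open>F \<in> H_cone a b\<close>, \<open>U_gap a b F\<close> is the maximum of a nondecreasing and a nonincreasing
  function of \<open>m\<close>, so its set of minimizers is an interval.\<close>

definition U_mode :: "real \<Rightarrow> real \<Rightarrow> (real \<Rightarrow> real) \<Rightarrow> real" where
  "U_mode a b F = (Inf (U_argmin a b F) + Sup (U_argmin a b F)) / 2"

definition U_S :: "real \<Rightarrow> real \<Rightarrow> (real \<Rightarrow> real) \<Rightarrow> real \<Rightarrow> real" where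
  "U_S a b F = U_slope a b (U_mode a b F) F"

definition primitive :: "real \<Rightarrow> (real \<Rightarrow> real) \<Rightarrow> real \<Rightarrow> real" where
  "primitive a g t = set_lebesgue_integral lborel {a..t} g"

definition histogram :: "partition \<Rightarrow> (real \<Rightarrow> real) \<Rightarrow> real \<Rightarrow> real" where
  "histogram \<pi> F t =
     (\<Sum>k\<in>pieces \<pi>. (F (knot \<pi> k) - F (knot \<pi> (k - 1))) / (knot \<pi> k - knot \<pi> (k - 1))
        * indicator {knot \<pi> (k - 1)..<knot \<pi> k} t)"

text \<open>Measurability of an estimator refers to the \<open>\<sigma>\<close>-algebra on \<open>H_cone a b\<close> generated by the
  evaluation maps.\<close>

definition estimator :: "real \<Rightarrow> real \<Rightarrow> 'x measure \<Rightarrow> ('x \<Rightarrow> real \<Rightarrow> real) \<Rightarrow> bool" where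
  "estimator a b N Gh \<longleftrightarrow>
     (\<forall>x\<in>space N. Gh x \<in> H_cone a b) \<and>
     (\<forall>t\<in>{a..b}. (\<lambda>x. Gh x t) \<in> borel_measurable N)"

definition err :: "real \<Rightarrow> (real \<Rightarrow> real) \<Rightarrow> ('x \<Rightarrow> real \<Rightarrow> real) \<Rightarrow> ('w \<Rightarrow> 'x) \<Rightarrow> 'w \<Rightarrow> real \<Rightarrow> real" where
  "err a g Gh X \<omega> t = Gh (X \<omega>) t - primitive a g t"

definition osc :: "(real \<Rightarrow> real) \<Rightarrow> real \<Rightarrow> real \<Rightarrow> ennreal" where
  "osc z s u = (SUP t\<in>{s..u}. ennreal \<bar>z t - z s\<bar>)"

definition risk_bound ::
  "real \<Rightarrow> real \<Rightarrow> real \<Rightarrow> (real \<Rightarrow> real) \<Rightarrow> 'w measure \<Rightarrow> ('w \<Rightarrow> real \<Rightarrow> real) \<Rightarrow> partition \<Rightarrow> ennreal" where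
  "risk_bound C a b g M Z \<pi> =
     4 * L1_dist_set a b g (H_part a b \<pi>)
     + ennreal C * (\<Sum>k\<in>pieces \<pi>. \<integral>\<^sup>+\<omega>. osc (Z \<omega>) (knot \<pi> (k - 1)) (knot \<pi> k) \<partial>M)"

text \<open>The defining property of the absolute constant \<open>C\<close>.  The intervals, the U-shaped functions,
  the laws and the estimators are all quantified here; the two type arguments only name the
  types carrying the probability space and the sample space.\<close>

definition absolute_constant :: "'w itself \<Rightarrow> 'x itself \<Rightarrow> real \<Rightarrow> bool" where
  "absolute_constant _ _ C \<longleftrightarrow>
     1 \<le> C \<and>
     (\<forall>a b g (M :: 'w measure) (N :: 'x measure) X Gh.
        a < b \<longrightarrow> U_shaped a b g \<longrightarrow> prob_space M \<longrightarrow> X \<in> measurable M N \<longrightarrow> estimator a b N Gh \<longrightarrow>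
        (\<integral>\<^sup>+\<omega>. L1_dist a b (U_S a b (Gh (X \<omega>))) g \<partial>M)
          \<le> (INF \<pi>\<in>partitions a b. risk_bound C a b g M (err a g Gh X) \<pi>))"

end

theory Submission
  imports Defs
begin

text \<open>
  Fix a partition and an outcome, and let \<open>Z\<close> be the difference between the estimate of the
  primitive of \<open>g\<close> and that primitive.  Over the \<open>k\<close>-th piece, the integral of the histogram is the
  increment of the estimate and the integral of \<open>g\<close> is the increment of its primitive.  So the
  increment \<open>\<Delta>\<^sub>k Z\<close> is the integral over the piece of the histogram minus \<open>g\<close>.  This one identity
  bounds the loss of the histogram on both sides.

  \<^item> From below: the loss on a piece is at least \<open>\<bar>\<Delta>\<^sub>k Z\<bar>\<close>.  Moreover the histogram is itself a
    competitor in the distance from \<open>g\<close> to the step functions on \<open>\<pi>\<close>, so the total loss is at least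
    that distance.

  \<^item> From above: the mean of \<open>g\<close> over a piece is an \<open>L\<^sup>1\<close> approximation of \<open>g\<close> by a constant that is
    optimal up to a factor two, and the histogram deviates from this mean by an error of total mass
    \<open>\<bar>\<Delta>\<^sub>k Z\<bar>\<close>.  So the loss is at most \<open>\<Sum>\<^sub>k \<bar>\<Delta>\<^sub>k Z\<bar>\<close> plus twice the distance.

  The comparisons with the increments are \<open>histogram_loss\<close>, and \<open>histogram_in_H_part\<close> makes the
  histogram a competitor.  After taking expectations, the bound from above gives the bound by the
  risk, since an increment is at most an oscillation and \<open>C \<ge> 1\<close>.  The bounds from below control
  both terms of the risk: the distance directly, and the oscillations through
  the hypothesis that compares their expectations with those of the increments.  The oracle
  inequality for the U-shaped estimator is then the defining property of \<open>C\<close> followed by this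
  control of the risk.
\<close>

section \<open>Integrability of U-shaped functions\<close>

lemma U_shaped_integrable:
  assumes "U_shaped a b g"
  shows "set_integrable lborel {a..b} g"
proof -
  obtain m where m: "a \<le> m" "m \<le> b" and anti: "antimono_on {a..m} g" and mono: "mono_on {m..b} g"
    using assms by (auto simp: U_shaped_def)
  have mono': "mono_on {a..m} (\<lambda>x. - g x)"
    using anti by (simp add: monotone_on_def)
  have g_meas: "(\<lambda>x. indicator S x *\<^sub>R g x) \<in> borel_measurable lborel"
    if "g \<in> borel_measurable (restrict_space borel S)" "S \<in> sets borel" for S
    using iffD1[OF borel_measurable_restrict_space_iff that(1)] that(2) by simp
  \<comment> \<open>The decreasing branch is the negative of an increasing function.\<close>
  have neg: "(\<lambda>x. - (- g x)) \<in> borel_measurable (restrict_space borel {a..m})"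
    by (intro borel_measurable_uminus borel_measurable_mono_on_fnc mono')
  have bnd: "norm (g x) \<le> \<bar>g m\<bar> + \<bar>g b\<bar>" if "x \<in> {m..b}" for x
    using monotone_onD[OF mono, of m x] monotone_onD[OF mono, of x b] m that by simp
  have bnd': "norm (g x) \<le> \<bar>g m\<bar> + \<bar>g a\<bar>" if "x \<in> {a..m}" for x
    using monotone_onD[OF anti, of a x] monotone_onD[OF anti, of x m] m that by simp
  have right: "set_integrable lborel {m..b} g"
    unfolding set_integrable_def
  proof (rule integrableI_bounded_set[where A="{m..b}" and B="\<bar>g m\<bar> + \<bar>g b\<bar>"])
    show "(\<lambda>x. indicat_real {m..b} x *\<^sub>R g x) \<in> borel_measurable lborel"
      by (intro g_meas borel_measurable_mono_on_fnc mono) simp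
  qed (use bnd m in \<open>auto simp: indicator_def\<close>)
  have left: "set_integrable lborel {a..m} g"
    unfolding set_integrable_def
  proof (rule integrableI_bounded_set[where A="{a..m}" and B="\<bar>g m\<bar> + \<bar>g a\<bar>"])
    show "(\<lambda>x. indicat_real {a..m} x *\<^sub>R g x) \<in> borel_measurable lborel"
      using neg by (intro g_meas) simp_all
  qed (use bnd' m in \<open>auto simp: indicator_def\<close>)
  have "set_integrable lborel ({a..m} \<union> {m..b}) g"
    by (intro set_integrable_Un left right) auto
  then show ?thesis
    using m by (simp add: ivl_disj_un_two_touch)
qed

text \<open>
  The primitive integrates over closed intervals; half-open ones match the pieces of a partition.
\<close>
lemma primitive_diff:
  assumes "set_integrable lborel {a..b} g" "a \<le> s" "s \<le> t" "t \<le> b"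
  shows "primitive a g t - primitive a g s = (LINT x:{s..<t}|lborel. g x)"
proof -
  have closed: "primitive a g u = (LINT x:{a..<u}|lborel. g x)" if "u \<le> b" for u
  proof -
    have "set_integrable lborel {a..u} g" "set_integrable lborel {a..<u} g"
      using that by (auto intro: set_integrable_subset[OF assms(1)])
    then show ?thesis
      unfolding primitive_def set_lebesgue_integral_def set_integrable_def
      using AE_lborel_singleton[of u]
      by (intro integral_cong_AE borel_measurable_integrable) (auto simp: indicator_def)
  qed
  have "{a..<t} = {a..<s} \<union> {s..<t}"
    using assms by auto
  moreover have "(LINT x:{a..<s} \<union> {s..<t}|lborel. g x)
      = (LINT x:{a..<s}|lborel. g x) + (LINT x:{s..<t}|lborel. g x)"
    using assms by (intro set_integral_Un set_integrable_subset[OF assms(1)]) auto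
  ultimately show ?thesis
    using assms by (simp add: closed)
qed

section \<open>Scaling an infimum\<close>

lemma ennreal_mult_inverse_cancel:
  assumes "0 < c"
  shows "ennreal (inverse c) * (ennreal c * y) = y" "ennreal c * (ennreal (inverse c) * y) = y"
  using assms by (simp_all flip: mult.assoc ennreal_mult)

text \<open>
  Scaling by a finite positive constant has a monotone inverse, so it can be pulled out of the
  infimum by dividing first.
\<close>
lemma ennreal_le_cmult_INF:
  assumes c: "0 < c" and le: "\<And>i. i \<in> I \<Longrightarrow> x \<le> ennreal c * f i"
  shows "x \<le> ennreal c * (INF i\<in>I. f i)"
proof -
  note cancel = ennreal_mult_inverse_cancel[OF c]
  have "ennreal (inverse c) * x \<le> f i" if "i \<in> I" for i
    using mult_left_mono[OF le[OF that], of "ennreal (inverse c)"] by (simp add: cancel)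
  then have "ennreal c * (ennreal (inverse c) * x) \<le> ennreal c * (INF i\<in>I. f i)"
    by (intro mult_left_mono INF_greatest) auto
  then show ?thesis
    by (simp only: cancel)
qed

section \<open>Approximation by a constant\<close>

lemma borel_measurable_deviation:
  fixes g :: "'a \<Rightarrow> real"
  assumes g: "set_integrable M S g" and S: "S \<in> sets M"
  shows "(\<lambda>x. ennreal \<bar>c - g x\<bar> * indicator S x) \<in> borel_measurable M"
proof -
  \<comment> \<open>Only the product of \<open>g\<close> with the indicator of \<open>S\<close> is known to be measurable.\<close>
  have "(\<lambda>x. ennreal \<bar>c * indicator S x - indicator S x *\<^sub>R g x\<bar>) \<in> borel_measurable M"
    using g S unfolding set_integrable_def by measurable
  also have "(\<lambda>x. ennreal \<bar>c * indicator S x - indicator S x *\<^sub>R g x\<bar>)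
      = (\<lambda>x. ennreal \<bar>c - g x\<bar> * indicator S x)"
    by (auto simp: indicator_def)
  finally show ?thesis .
qed

lemma integral_deviation_le:
  fixes g :: "'a \<Rightarrow> real"
  assumes g: "set_integrable M S g" and S: "S \<in> sets M" "emeasure M S < \<infinity>"
  shows "ennreal \<bar>v * measure M S - (LINT x:S|M. g x)\<bar> \<le> (\<integral>\<^sup>+x\<in>S. ennreal \<bar>v - g x\<bar> \<partial>M)"
proof -
  have v: "set_integrable M S (\<lambda>_. v)"
    using S by (simp add: set_integrable_def)
  have "v * measure M S - (LINT x:S|M. g x) = (LINT x:S|M. v - g x)"
    using S by (simp add: set_integral_diff(2)[OF v g] set_integral_const less_top)
  also have "ennreal \<bar>\<dots>\<bar> \<le> (\<integral>\<^sup>+x. norm (indicator S x *\<^sub>R (v - g x)) \<partial>M)"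
    using integral_norm_bound_ennreal[of M "\<lambda>x. indicator S x *\<^sub>R (v - g x)"]
      set_integral_diff(1)[OF v g]
    by (simp add: set_integrable_def set_lebesgue_integral_def)
  also have "\<dots> = (\<integral>\<^sup>+x\<in>S. ennreal \<bar>v - g x\<bar> \<partial>M)"
    by (intro nn_integral_cong) (auto simp: indicator_def)
  finally show ?thesis .
qed

text \<open>
  If \<open>v\<close> is the mean of \<open>g\<close> over \<open>S\<close>, the first term on the right vanishes and the bound says that
  the mean is optimal among constants up to a factor two.  In general \<open>v\<close> is a perturbed mean.
  The reason is that the triangle inequality through \<open>c\<close> leaves \<open>\<bar>v - c\<bar>\<close> times the measure of
  \<open>S\<close>, and \<open>c\<close> is as close to the mean as \<open>integral_deviation_le\<close> says.
\<close>
lemma L1_const_le: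
  fixes g :: "'a \<Rightarrow> real"
  assumes g: "set_integrable M S g" and S: "S \<in> sets M" "emeasure M S < \<infinity>"
  shows "(\<integral>\<^sup>+x\<in>S. ennreal \<bar>v - g x\<bar> \<partial>M)
    \<le> ennreal \<bar>v * measure M S - (LINT x:S|M. g x)\<bar> + 2 * (\<integral>\<^sup>+x\<in>S. ennreal \<bar>c - g x\<bar> \<partial>M)"
proof -
  note gm = borel_measurable_deviation[OF g S(1)]
  let ?\<mu> = "measure M S" and ?J = "LINT x:S|M. g x"
  have "(\<integral>\<^sup>+x\<in>S. ennreal \<bar>v - g x\<bar> \<partial>M)
      \<le> (\<integral>\<^sup>+x. ennreal \<bar>v - c\<bar> * indicator S x + ennreal \<bar>c - g x\<bar> * indicator S x \<partial>M)"
    by (intro nn_integral_mono) (auto simp: indicator_def simp flip: ennreal_plus)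
  also have "\<dots> = ennreal \<bar>v - c\<bar> * emeasure M S + (\<integral>\<^sup>+x\<in>S. ennreal \<bar>c - g x\<bar> \<partial>M)"
    using S gm by (simp add: nn_integral_add nn_integral_cmult_indicator)
  also have "ennreal \<bar>v - c\<bar> * emeasure M S = ennreal \<bar>v * ?\<mu> - c * ?\<mu>\<bar>"
    using S by (simp add: emeasure_eq_ennreal_measure less_top ennreal_mult' abs_mult
        flip: left_diff_distrib)
  also have "ennreal \<bar>v * ?\<mu> - c * ?\<mu>\<bar> \<le> ennreal \<bar>v * ?\<mu> - ?J\<bar> + ennreal \<bar>c * ?\<mu> - ?J\<bar>"
    by (simp flip: ennreal_plus)
  also have "ennreal \<bar>c * ?\<mu> - ?J\<bar> \<le> (\<integral>\<^sup>+x\<in>S. ennreal \<bar>c - g x\<bar> \<partial>M)"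
    by (rule integral_deviation_le[OF g S])
  finally show ?thesis
    by (simp add: mult_2 add.assoc add_left_mono add_right_mono)
qed

section \<open>Step functions on a partition\<close>

lemma sum_indicator_consecutive:
  fixes t :: "nat \<Rightarrow> real"
  assumes "\<forall>k\<in>{1..n}. t (k - 1) < t k"
  shows "t 0 \<le> t n"
    and "(\<Sum>k\<in>{1..n}. indicator {t (k - 1)..<t k} x :: 'a::semiring_1) = indicator {t 0..<t n} x"
  using assms
proof (induction n)
  case (Suc n)
  {
    case 1
    then show ?case using Suc(1) by force
  next
    case 2
    then have "t 0 \<le> t n" "t n < t (Suc n)"
      using Suc(1) bspec[OF 2, of "Suc n"] by auto
    then show ?case using 2 Suc(2) by (auto simp: indicator_def)
  }
qed auto

lemma partition_knot_mono:
  assumes "\<pi> \<in> partitions a b" "i \<le> j" "j \<le> fst \<pi>"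
  shows "knot \<pi> i \<le> knot \<pi> j"
  using assms(2,3)
proof (induction j rule: dec_induct)
  case (step j)
  have "knot \<pi> (Suc j - 1) < knot \<pi> (Suc j)"
    using assms(1) step by (auto simp: partitions_def dest!: bspec[where x="Suc j"])
  then show ?case using step by simp
qed simp

lemma partition_knots:
  assumes "\<pi> \<in> partitions a b" "k \<in> pieces \<pi>"
  shows "knot \<pi> (k - 1) < knot \<pi> k" "a \<le> knot \<pi> (k - 1)" "knot \<pi> k \<le> b"
    "knot \<pi> (k - 1) \<in> {a..b}" "knot \<pi> k \<in> {a..b}"
proof -
  show *: "knot \<pi> (k - 1) < knot \<pi> k"
    using assms by (auto simp: partitions_def)
  have "knot \<pi> 0 = a" "knot \<pi> (fst \<pi>) = b"
    using assms by (auto simp: partitions_def)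
  then show "a \<le> knot \<pi> (k - 1)" "knot \<pi> k \<le> b"
    using partition_knot_mono[OF assms(1), of 0 "k - 1"]
      partition_knot_mono[OF assms(1), of k "fst \<pi>"] assms(2) by auto
  with * show "knot \<pi> (k - 1) \<in> {a..b}" "knot \<pi> k \<in> {a..b}" by auto
qed

lemma sum_indicator_pieces:
  assumes "\<pi> \<in> partitions a b"
  shows "(\<Sum>k\<in>pieces \<pi>. indicator {knot \<pi> (k - 1)..<knot \<pi> k} x :: 'a::semiring_1)
    = indicator {a..<b} x"
  using sum_indicator_consecutive(2)[of "fst \<pi>" "knot \<pi>" x] assms
  by (auto simp: partitions_def)

lemma pieces_cover:
  assumes "\<pi> \<in> partitions a b" "a \<le> x" "x < b"
  obtains k where "k \<in> pieces \<pi>" "x \<in> {knot \<pi> (k - 1)..<knot \<pi> k}"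
proof -
  have "(\<Sum>k\<in>pieces \<pi>. indicator {knot \<pi> (k - 1)..<knot \<pi> k} x) \<noteq> (0 :: nat)"
    using assms(2,3) by (simp only: sum_indicator_pieces[OF assms(1)]) simp
  then obtain k where "k \<in> pieces \<pi>" "indicator {knot \<pi> (k - 1)..<knot \<pi> k} x \<noteq> (0 :: nat)"
    by (rule sum.not_neutral_contains_not_neutral)
  then show ?thesis
    by (intro that) (auto simp: indicator_def split: if_splits)
qed

lemma pieces_disjoint:
  assumes "\<pi> \<in> partitions a b" "j \<in> pieces \<pi>" "k \<in> pieces \<pi>"
    "x \<in> {knot \<pi> (j - 1)..<knot \<pi> j}" "x \<in> {knot \<pi> (k - 1)..<knot \<pi> k}"
  shows "j = k"
proof (rule ccontr)
  assume "j \<noteq> k"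
  then consider "j \<le> k - 1" "k - 1 \<le> fst \<pi>" | "k \<le> j - 1" "j - 1 \<le> fst \<pi>"
    using assms(2,3) by fastforce
  then show False
    using partition_knot_mono[OF assms(1), of j "k - 1"]
      partition_knot_mono[OF assms(1), of k "j - 1"] assms(4,5) by cases fastforce+
qed

text \<open>
  Such a function is cadlag because on either side of any point it is eventually constant; the
  constant on the right is the value at the point, since a piece contains its left end point.
\<close>
lemma step_function_in_H_part:
  assumes \<pi>: "\<pi> \<in> partitions a b"
    and c: "\<And>k x. k \<in> pieces \<pi> \<Longrightarrow> x \<in> {knot \<pi> (k - 1)..<knot \<pi> k} \<Longrightarrow> f x = c k"
  shows "f \<in> H_part a b \<pi>"
proof -
  have "continuous (at_right x) f" if x: "x \<in> {a..<b}" for x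
  proof -
    obtain k where k: "k \<in> pieces \<pi>" "x \<in> {knot \<pi> (k - 1)..<knot \<pi> k}"
      using pieces_cover[OF \<pi>] x by auto
    have "\<forall>\<^sub>F y in at_right x. f y = f x"
      unfolding eventually_at_right_field using c k by (auto intro!: exI[of _ "knot \<pi> k"])
    then show ?thesis
      by (simp add: continuous_within tendsto_eventually)
  qed
  moreover have "\<exists>l. (f \<longlongrightarrow> l) (at_left x)" if x: "x \<in> {a<..b}" for x
  proof -
    \<comment> \<open>The piece to the left of \<open>x\<close> is the one with the least right end point that is at least \<open>x\<close>.\<close>
    define k where "k = (LEAST k. x \<le> knot \<pi> k)"
    have end_pts: "knot \<pi> 0 = a" "knot \<pi> (fst \<pi>) = b"
      using \<pi> by (auto simp: partitions_def)
    have "x \<le> knot \<pi> (fst \<pi>)"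
      using x end_pts by simp
    then have k: "x \<le> knot \<pi> k" "k \<le> fst \<pi>"
      unfolding k_def by (rule LeastI, rule Least_le)
    moreover have "k \<noteq> 0"
      using k x end_pts by (intro notI) auto
    moreover have "knot \<pi> (k - 1) < x"
      using not_less_Least[of "k - 1" "\<lambda>k. x \<le> knot \<pi> k"] \<open>k \<noteq> 0\<close> by (simp add: k_def not_le)
    ultimately have "\<forall>\<^sub>F y in at_left x. f y = c k"
      unfolding eventually_at_left_field using c[of k]
      by (auto intro!: exI[of _ "knot \<pi> (k - 1)"])
    then show ?thesis
      by (blast intro: tendsto_eventually)
  qed
  ultimately show ?thesis
    using c by (auto simp: H_part_def cadlag_on_def constant_on_def)
qed

text \<open>
  Turns the distance between \<open>g\<close> and a step function into separate problems of approximating \<open>g\<close>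
  by a constant.
\<close>
lemma L1_dist_step_function:
  assumes \<pi>: "\<pi> \<in> partitions a b" and g: "set_integrable lborel {a..b} g"
    and c: "\<And>k x. k \<in> pieces \<pi> \<Longrightarrow> x \<in> {knot \<pi> (k - 1)..<knot \<pi> k} \<Longrightarrow> f x = c k"
  shows "L1_dist a b f g
    = (\<Sum>k\<in>pieces \<pi>. \<integral>\<^sup>+x\<in>{knot \<pi> (k - 1)..<knot \<pi> k}. ennreal \<bar>c k - g x\<bar> \<partial>lborel)"
proof -
  let ?I = "\<lambda>k. {knot \<pi> (k - 1)..<knot \<pi> k}"
  have gm: "(\<lambda>x. ennreal \<bar>c k - g x\<bar> * indicator (?I k) x) \<in> borel_measurable lborel"
    if "k \<in> pieces \<pi>" for k
    using partition_knots[OF \<pi> that]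
    by (intro borel_measurable_deviation set_integrable_subset[OF g]) auto
  have "L1_dist a b f g = (\<integral>\<^sup>+x\<in>{a..<b}. ennreal \<bar>f x - g x\<bar> \<partial>lborel)"
    unfolding L1_dist_def
    by (rule nn_integral_cong_AE) (use AE_lborel_singleton[of b] in \<open>auto simp: indicator_def\<close>)
  also have "\<dots> = (\<integral>\<^sup>+x. (\<Sum>k\<in>pieces \<pi>. ennreal \<bar>f x - g x\<bar> * indicator (?I k) x) \<partial>lborel)"
    by (simp only: sum_indicator_pieces[OF \<pi>] sum_distrib_left[symmetric])
  also have "\<dots> = (\<integral>\<^sup>+x. (\<Sum>k\<in>pieces \<pi>. ennreal \<bar>c k - g x\<bar> * indicator (?I k) x) \<partial>lborel)"
    using c by (intro nn_integral_cong sum.cong) (auto simp: indicator_def)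
  also have "\<dots> = (\<Sum>k\<in>pieces \<pi>. \<integral>\<^sup>+x\<in>?I k. ennreal \<bar>c k - g x\<bar> \<partial>lborel)"
    using gm by (rule nn_integral_sum)
  finally show ?thesis .
qed

section \<open>The loss of the histogram\<close>

lemma histogram_on_piece:
  assumes \<pi>: "\<pi> \<in> partitions a b" and k: "k \<in> pieces \<pi>" and x: "x \<in> {knot \<pi> (k - 1)..<knot \<pi> k}"
  shows "histogram \<pi> F x = (F (knot \<pi> k) - F (knot \<pi> (k - 1))) / (knot \<pi> k - knot \<pi> (k - 1))"
proof -
  have "indicator {knot \<pi> (j - 1)..<knot \<pi> j} x = (if j = k then 1 else 0 :: real)"
    if "j \<in> pieces \<pi>" for j
  proof (cases "j = k")
    case False
    then have "x \<notin> {knot \<pi> (j - 1)..<knot \<pi> j}"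
      using pieces_disjoint[OF \<pi> that k _ x] by blast
    with False show ?thesis by simp
  qed (use x in simp)
  then have "histogram \<pi> F x = (\<Sum>j\<in>pieces \<pi>. if j = k
      then (F (knot \<pi> j) - F (knot \<pi> (j - 1))) / (knot \<pi> j - knot \<pi> (j - 1)) else 0)"
    unfolding histogram_def by (intro sum.cong) simp_all
  then show ?thesis
    using k by (simp only: sum.delta finite_atLeastAtMost if_True)
qed

lemma histogram_in_H_part:
  "\<pi> \<in> partitions a b \<Longrightarrow> histogram \<pi> F \<in> H_part a b \<pi>"
  by (rule step_function_in_H_part, assumption, rule histogram_on_piece)

text \<open>
  Both bounds are sums over the pieces of \<open>integral_deviation_le\<close> and \<open>L1_const_le\<close>, where \<open>v\<close> is
  the height of the histogram.  It is a difference quotient of \<open>F\<close>, so \<open>v\<close> times the length of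
  the piece minus the integral of \<open>g\<close> is exactly the increment of \<open>Z\<close>.
\<close>
lemma histogram_loss:
  fixes F :: "real \<Rightarrow> real"
  assumes \<pi>: "\<pi> \<in> partitions a b" and g: "set_integrable lborel {a..b} g"
  defines "Z \<equiv> \<lambda>t. F t - primitive a g t"
  defines "V \<equiv> \<Sum>k\<in>pieces \<pi>. ennreal \<bar>Z (knot \<pi> k) - Z (knot \<pi> (k - 1))\<bar>"
  shows "V \<le> L1_dist a b (histogram \<pi> F) g"
    and "L1_dist a b (histogram \<pi> F) g \<le> V + 2 * L1_dist_set a b g (H_part a b \<pi>)"
proof -
  let ?I = "\<lambda>k. {knot \<pi> (k - 1)..<knot \<pi> k}"
  let ?v = "\<lambda>k. (F (knot \<pi> k) - F (knot \<pi> (k - 1))) / (knot \<pi> k - knot \<pi> (k - 1))"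
  have hist: "L1_dist a b (histogram \<pi> F) g
      = (\<Sum>k\<in>pieces \<pi>. \<integral>\<^sup>+x\<in>?I k. ennreal \<bar>?v k - g x\<bar> \<partial>lborel)"
    by (intro L1_dist_step_function[OF \<pi> g] histogram_on_piece[OF \<pi>])
  have int: "set_integrable lborel (?I k) g" if "k \<in> pieces \<pi>" for k
    using partition_knots[OF \<pi> that] by (intro set_integrable_subset[OF g]) auto
  have incr: "?v k * measure lborel (?I k) - (LINT x:?I k|lborel. g x)
      = Z (knot \<pi> k) - Z (knot \<pi> (k - 1))" if "k \<in> pieces \<pi>" for k
    using partition_knots[OF \<pi> that] primitive_diff[OF g, of "knot \<pi> (k - 1)" "knot \<pi> k"]
    by (simp add: Z_def)
  have fin: "?I k \<in> sets lborel" "emeasure lborel (?I k) < \<infinity>" if "k \<in> pieces \<pi>" for k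
    using partition_knots(1)[OF \<pi> that] by simp_all
  show "V \<le> L1_dist a b (histogram \<pi> F) g"
    unfolding V_def hist
  proof (rule sum_mono)
    fix k assume k: "k \<in> pieces \<pi>"
    show "ennreal \<bar>Z (knot \<pi> k) - Z (knot \<pi> (k - 1))\<bar> \<le> (\<integral>\<^sup>+x\<in>?I k. ennreal \<bar>?v k - g x\<bar> \<partial>lborel)"
      using integral_deviation_le[OF int fin, OF k k k, of "?v k"] by (simp only: incr[OF k])
  qed
  \<comment> \<open>Finiteness lets \<open>V\<close> move to the left, so that only a multiple of the infimum remains on the right.\<close>
  have V: "V \<noteq> \<top>"
    by (simp add: V_def)
  have "L1_dist a b (histogram \<pi> F) g - V \<le> ennreal 2 * L1_dist a b g h" if h: "h \<in> H_part a b \<pi>" for h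
  proof -
    obtain c where c: "\<And>k x. k \<in> pieces \<pi> \<Longrightarrow> x \<in> ?I k \<Longrightarrow> h x = c k"
    proof -
      have "\<forall>k\<in>pieces \<pi>. \<exists>y. \<forall>x\<in>?I k. h x = y"
        using h by (simp add: H_part_def constant_on_def)
      from bchoice[OF this] show ?thesis
        using that by blast
    qed
    have dist_h: "L1_dist a b h g = (\<Sum>k\<in>pieces \<pi>. \<integral>\<^sup>+x\<in>?I k. ennreal \<bar>c k - g x\<bar> \<partial>lborel)"
      by (intro L1_dist_step_function[OF \<pi> g] c)
    have "(\<integral>\<^sup>+x\<in>?I k. ennreal \<bar>?v k - g x\<bar> \<partial>lborel)
      \<le> ennreal \<bar>Z (knot \<pi> k) - Z (knot \<pi> (k - 1))\<bar>
        + 2 * (\<integral>\<^sup>+x\<in>?I k. ennreal \<bar>c k - g x\<bar> \<partial>lborel)" if k: "k \<in> pieces \<pi>" for k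
      using L1_const_le[OF int fin, OF k k k, of "?v k" "c k"] by (simp only: incr[OF k])
    then have "L1_dist a b (histogram \<pi> F) g \<le> V + 2 * L1_dist a b h g"
      unfolding hist V_def dist_h sum_distrib_left sum.distrib[symmetric]
      by (rule sum_mono)
    then show ?thesis
      using V by (simp add: L1_dist_def abs_minus_commute ennreal_minus_le_iff)
  qed
  then have "L1_dist a b (histogram \<pi> F) g - V \<le> ennreal 2 * L1_dist_set a b g (H_part a b \<pi>)"
    unfolding L1_dist_set_def by (intro ennreal_le_cmult_INF) auto
  then show "L1_dist a b (histogram \<pi> F) g \<le> V + 2 * L1_dist_set a b g (H_part a b \<pi>)"
    using V by (simp add: ennreal_minus_le_iff)
qed

section \<open>Risk bounds in expectation\<close>

theorem theorem3:
  fixes a b A C :: real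
    and g :: "real \<Rightarrow> real"
    and M :: "'w measure" and N :: "'x measure"
    and X :: "'w \<Rightarrow> 'x" and Gh :: "'x \<Rightarrow> real \<Rightarrow> real"
  assumes "absolute_constant TYPE('w) TYPE('x) C"
    and "a < b"
    and "U_shaped a b g"
    and "prob_space M"
    and "X \<in> measurable M N"
    and "estimator a b N Gh"
    and "A > 0"
    and "\<And>\<pi> k. \<pi> \<in> partitions a b \<Longrightarrow> k \<in> pieces \<pi> \<Longrightarrow>
           (\<integral>\<^sup>+\<omega>. osc (err a g Gh X \<omega>) (knot \<pi> (k - 1)) (knot \<pi> k) \<partial>M)
             \<le> ennreal A *
               (\<integral>\<^sup>+\<omega>. ennreal \<bar>err a g Gh X \<omega> (knot \<pi> k) - err a g Gh X \<omega> (knot \<pi> (k - 1))\<bar> \<partial>M)"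
  shows "(\<forall>\<pi>\<in>partitions a b.
            ennreal (inverse (C * A + 8)) * risk_bound C a b g M (err a g Gh X) \<pi>
              \<le> (\<integral>\<^sup>+\<omega>. L1_dist a b (histogram \<pi> (Gh (X \<omega>))) g \<partial>M)
          \<and> (\<integral>\<^sup>+\<omega>. L1_dist a b (histogram \<pi> (Gh (X \<omega>))) g \<partial>M)
              \<le> risk_bound C a b g M (err a g Gh X) \<pi>)
       \<and> (\<integral>\<^sup>+\<omega>. L1_dist a b (U_S a b (Gh (X \<omega>))) g \<partial>M)
            \<le> ennreal (C * A + 8) *
              (INF \<pi>\<in>partitions a b. \<integral>\<^sup>+\<omega>. L1_dist a b (histogram \<pi> (Gh (X \<omega>))) g \<partial>M)"
proof -
  interpret prob_space M by fact
  let ?Z = "err a g Gh X"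
  let ?d = "\<lambda>\<pi>. L1_dist_set a b g (H_part a b \<pi>)"
  let ?V = "\<lambda>\<pi>. \<Sum>k\<in>pieces \<pi>.
    \<integral>\<^sup>+\<omega>. ennreal \<bar>?Z \<omega> (knot \<pi> k) - ?Z \<omega> (knot \<pi> (k - 1))\<bar> \<partial>M"
  let ?O = "\<lambda>\<pi>. \<Sum>k\<in>pieces \<pi>. \<integral>\<^sup>+\<omega>. osc (?Z \<omega>) (knot \<pi> (k - 1)) (knot \<pi> k) \<partial>M"
  let ?R = "risk_bound C a b g M ?Z"
  let ?E = "\<lambda>\<pi>. \<integral>\<^sup>+\<omega>. L1_dist a b (histogram \<pi> (Gh (X \<omega>))) g \<partial>M"
  have C: "1 \<le> C"
    using assms(1) by (simp add: absolute_constant_def)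
  have g: "set_integrable lborel {a..b} g"
    by (rule U_shaped_integrable) fact
  have Z_meas [measurable]: "(\<lambda>\<omega>. ?Z \<omega> t) \<in> borel_measurable M" if "t \<in> {a..b}" for t
    using assms(5,6) that unfolding err_def estimator_def
    by (intro borel_measurable_diff borel_measurable_const) (auto intro: measurable_compose)
  have V_meas: "(\<lambda>\<omega>. ennreal \<bar>?Z \<omega> (knot \<pi> k) - ?Z \<omega> (knot \<pi> (k - 1))\<bar>) \<in> borel_measurable M"
    if "\<pi> \<in> partitions a b" "k \<in> pieces \<pi>" for \<pi> k
    using Z_meas[OF partition_knots(4)[OF that]] Z_meas[OF partition_knots(5)[OF that]]
    by measurable
  have V: "?V \<pi> = (\<integral>\<^sup>+\<omega>. (\<Sum>k\<in>pieces \<pi>.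
      ennreal \<bar>?Z \<omega> (knot \<pi> k) - ?Z \<omega> (knot \<pi> (k - 1))\<bar>) \<partial>M)"
    if "\<pi> \<in> partitions a b" for \<pi>
    using V_meas[OF that] by (rule nn_integral_sum[symmetric])
  have V_le: "?V \<pi> \<le> ?E \<pi>" if \<pi>: "\<pi> \<in> partitions a b" for \<pi>
    unfolding V[OF \<pi>] unfolding err_def by (intro nn_integral_mono histogram_loss(1)[OF \<pi> g])
  have d_le: "?d \<pi> \<le> ?E \<pi>" if \<pi>: "\<pi> \<in> partitions a b" for \<pi>
  proof -
    have "?d \<pi> \<le> L1_dist a b (histogram \<pi> F) g" for F
      unfolding L1_dist_set_def L1_dist_def
      using histogram_in_H_part[OF \<pi>, of F] by (intro INF_lower2) (auto simp: abs_minus_commute)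
    then have "(\<integral>\<^sup>+\<omega>. ?d \<pi> \<partial>M) \<le> ?E \<pi>"
      by (intro nn_integral_mono)
    then show ?thesis
      by (simp add: emeasure_space_1)
  qed
  have upper: "?E \<pi> \<le> ?R \<pi>" if \<pi>: "\<pi> \<in> partitions a b" for \<pi>
  proof -
    have "?E \<pi> \<le> (\<integral>\<^sup>+\<omega>. (\<Sum>k\<in>pieces \<pi>.
        ennreal \<bar>?Z \<omega> (knot \<pi> k) - ?Z \<omega> (knot \<pi> (k - 1))\<bar>) + 2 * ?d \<pi> \<partial>M)"
      unfolding err_def by (intro nn_integral_mono histogram_loss(2)[OF \<pi> g])
    also have "\<dots> = ?V \<pi> + 2 * ?d \<pi>"
      using V_meas[OF \<pi>] unfolding V[OF \<pi>]
      by (subst nn_integral_add)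
         (simp_all only: borel_measurable_sum borel_measurable_const nn_integral_const
           emeasure_space_1 mult_1_right)
    also have "\<dots> \<le> ?O \<pi> + 4 * ?d \<pi>"
    proof (intro add_mono mult_right_mono)
      show "?V \<pi> \<le> ?O \<pi>"
        unfolding osc_def
      proof (intro sum_mono nn_integral_mono SUP_upper)
        show "knot \<pi> k \<in> {knot \<pi> (k - 1)..knot \<pi> k}" if "k \<in> pieces \<pi>" for k
          using partition_knots(1)[OF \<pi> that] by simp
      qed
    qed simp_all
    also have "\<dots> \<le> ennreal C * ?O \<pi> + 4 * ?d \<pi>"
      using mult_right_mono[of 1 "ennreal C" "?O \<pi>"] C
      by (intro add_right_mono) simp
    finally show ?thesis
      unfolding risk_bound_def by (subst add.commute)
  qed
  have lower: "?R \<pi> \<le> ennreal (C * A + 8) * ?E \<pi>" if \<pi>: "\<pi> \<in> partitions a b" for \<pi>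
  proof -
    have "?R \<pi> \<le> 4 * ?d \<pi> + ennreal C * (ennreal A * ?V \<pi>)"
      unfolding risk_bound_def sum_distrib_left[of "ennreal A"]
      by (intro add_left_mono mult_left_mono sum_mono assms(8)[OF \<pi>]) auto
    also have "\<dots> \<le> 8 * ?E \<pi> + ennreal C * (ennreal A * ?E \<pi>)"
      by (intro add_mono mult_mono d_le V_le \<pi>) auto
    also have "\<dots> = (ennreal C * ennreal A + 8) * ?E \<pi>"
      by (simp only: distrib_right mult.assoc add.commute)
    also have "ennreal C * ennreal A + 8 = ennreal (C * A + 8)"
      using C \<open>A > 0\<close> by (simp add: ennreal_mult)
    finally show ?thesis .
  qed
  have pos: "0 < C * A + 8"
    using C \<open>A > 0\<close> by (intro add_nonneg_pos) auto
  have lower': "ennreal (inverse (C * A + 8)) * ?R \<pi> \<le> ?E \<pi>" if "\<pi> \<in> partitions a b" for \<pi>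
  proof -
    have "ennreal (inverse (C * A + 8)) * ?R \<pi>
        \<le> ennreal (inverse (C * A + 8)) * (ennreal (C * A + 8) * ?E \<pi>)"
      by (intro mult_left_mono lower that) auto
    also have "\<dots> = ?E \<pi>"
      by (rule ennreal_mult_inverse_cancel(1)[OF pos])
    finally show ?thesis .
  qed
  have "(\<integral>\<^sup>+\<omega>. L1_dist a b (U_S a b (Gh (X \<omega>))) g \<partial>M) \<le> (INF \<pi>\<in>partitions a b. ?R \<pi>)"
    using assms(1-6) unfolding absolute_constant_def by blast
  then have "(\<integral>\<^sup>+\<omega>. L1_dist a b (U_S a b (Gh (X \<omega>))) g \<partial>M) \<le> ennreal (C * A + 8) * ?E \<pi>"
    if "\<pi> \<in> partitions a b" for \<pi>
    by (rule order_trans[OF _ INF_lower2[where f="?R", OF that lower[OF that]]])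
  then have "(\<integral>\<^sup>+\<omega>. L1_dist a b (U_S a b (Gh (X \<omega>))) g \<partial>M)
      \<le> ennreal (C * A + 8) * (INF \<pi>\<in>partitions a b. ?E \<pi>)"
    by (rule ennreal_le_cmult_INF[OF pos])
  then show ?thesis
    by (intro conjI ballI lower' upper)
qed

end
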